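(* Let $\kappa\in\mathbb{R}$, $\gamma>0$, and $$\mathcal{S}_{\kappa,\gamma}=\{(x,y)\in(0,\infty)^2:\kappa x+\gamma y=1,\ \gamma x^2+2y^2=2y\}.$$ (0) If $(\kappa,\gamma)\in\mathcal{J}_0$, then $\mathcal{S}_{\kappa,\gamma}$ is empty. (1) If $(\kappa,\gamma)\in\mathcal{J}_1$, then $\mathcal{S}_{\kappa,\gamma}=\{(\alpha_{+},\beta_{-})\}$. (2) If $(\kappa,\gamma)\in\mathcal{J}_2$, then $\mathcal{S}_{\kappa,\gamma}=\{(\alpha_{+},\beta_{-}),(\alpha_{-},\beta_{+})\}$. (3) If $(\kappa,\gamma)\in\mathcal{J}_3$, then $\mathcal{S}_{\kappa,\gamma}=\{(\alpha_{0},\beta_{0})\}$.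
   Context: For $\kappa^2\ge 2\gamma(1-\gamma)$ define $$\alpha_{\pm}=\frac{(2-\gamma)\kappa\pm\gamma\sqrt{\kappa^2+2\gamma(\gamma-1)}}{2\kappa^2+\gamma^3},\qquad \beta_{\pm}=\frac{\kappa^2+\gamma^2\pm\kappa\sqrt{\kappa^2+2\gamma(\gamma-1)}}{2\kappa^2+\gamma^3},$$ $$\alpha_0=\frac{(2-\gamma)\kappa}{2\kappa^2+\gamma^3},\qquad \beta_0=\frac{\kappa^2+\gamma^2}{2\kappa^2+\gamma^3}.$$ Parameter sets: $\mathcal{J}_1=\{(\kappa,\gamma):\kappa\le 0,\ \gamma>1\}\cup\{(\kappa,\gamma):\kappa>0,\ \gamma\ge 1\}$, $\mathcal{J}_2=\{(\kappa,\gamma):0<\gamma<1,\ \kappa>\sqrt{2\gamma(1-\gamma)}\}$, $\mathcal{J}_3=\{(\kappa,\gamma):0<\gamma<1,\ \kappa=\sqrt{2\gamma(1-\gamma)}\}$, $\mathcal{J}_0=\{(\kappa,\gamma):\kappa\in\mathbb{R},\ \gamma>0\}\setminus(\mathcal{J}_1\cup\mathcal{J}_2\cup\mathcal{J}_3)$. *)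

theory Defs
  imports Complex_Main
begin

text \<open>
  The functions \<open>alpha_p\<close>, \<open>alpha_m\<close>, \<open>beta_p\<close>, \<open>beta_m\<close> are meant for
  \<open>\<kappa>\<^sup>2 \<ge> 2 * \<gamma> * (1 - \<gamma>)\<close>, where the radicand is nonnegative; elsewhere
  they are total functions with no intended meaning.
\<close>

definition alpha_p :: "real \<Rightarrow> real \<Rightarrow> real" where
  "alpha_p \<kappa> \<gamma> =
    ((2 - \<gamma>) * \<kappa> + \<gamma> * sqrt (\<kappa>^2 + 2 * \<gamma> * (\<gamma> - 1))) / (2 * \<kappa>^2 + \<gamma>^3)"

definition alpha_m :: "real \<Rightarrow> real \<Rightarrow> real" where
  "alpha_m \<kappa> \<gamma> =
    ((2 - \<gamma>) * \<kappa> - \<gamma> * sqrt (\<kappa>^2 + 2 * \<gamma> * (\<gamma> - 1))) / (2 * \<kappa>^2 + \<gamma>^3)"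

definition beta_p :: "real \<Rightarrow> real \<Rightarrow> real" where
  "beta_p \<kappa> \<gamma> =
    (\<kappa>^2 + \<gamma>^2 + \<kappa> * sqrt (\<kappa>^2 + 2 * \<gamma> * (\<gamma> - 1))) / (2 * \<kappa>^2 + \<gamma>^3)"

definition beta_m :: "real \<Rightarrow> real \<Rightarrow> real" where
  "beta_m \<kappa> \<gamma> =
    (\<kappa>^2 + \<gamma>^2 - \<kappa> * sqrt (\<kappa>^2 + 2 * \<gamma> * (\<gamma> - 1))) / (2 * \<kappa>^2 + \<gamma>^3)"

definition alpha_0 :: "real \<Rightarrow> real \<Rightarrow> real" where
  "alpha_0 \<kappa> \<gamma> = (2 - \<gamma>) * \<kappa> / (2 * \<kappa>^2 + \<gamma>^3)"

definition beta_0 :: "real \<Rightarrow> real \<Rightarrow> real" where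
  "beta_0 \<kappa> \<gamma> = (\<kappa>^2 + \<gamma>^2) / (2 * \<kappa>^2 + \<gamma>^3)"

definition J1 :: "(real \<times> real) set" where
  "J1 = {(\<kappa>, \<gamma>). \<kappa> \<le> 0 \<and> \<gamma> > 1} \<union> {(\<kappa>, \<gamma>). \<kappa> > 0 \<and> \<gamma> \<ge> 1}"

definition J2 :: "(real \<times> real) set" where
  "J2 = {(\<kappa>, \<gamma>). 0 < \<gamma> \<and> \<gamma> < 1 \<and> \<kappa> > sqrt (2 * \<gamma> * (1 - \<gamma>))}"

definition J3 :: "(real \<times> real) set" where
  "J3 = {(\<kappa>, \<gamma>). 0 < \<gamma> \<and> \<gamma> < 1 \<and> \<kappa> = sqrt (2 * \<gamma> * (1 - \<gamma>))}"

definition J0 :: "(real \<times> real) set" where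
  "J0 = {(\<kappa>, \<gamma>). \<gamma> > 0} - (J1 \<union> J2 \<union> J3)"

definition sol_set :: "real \<Rightarrow> real \<Rightarrow> (real \<times> real) set" where
  "sol_set \<kappa> \<gamma> =
    {(x, y). x > 0 \<and> y > 0 \<and> \<kappa> * x + \<gamma> * y = 1 \<and> \<gamma> * x^2 + 2 * y^2 = 2 * y}"

end

theory Submission
  imports Defs
begin

text \<open>
  Eliminating \<open>y\<close> by the linear equation leaves the quadratic
  \<open>(2\<kappa>\<^sup>2 + \<gamma>\<^sup>3) x\<^sup>2 - 2 (2 - \<gamma>) \<kappa> x + 2 (1 - \<gamma>) = 0\<close>, whose quarter discriminant is
  \<open>\<gamma>\<^sup>2 (\<kappa>\<^sup>2 + 2 \<gamma> (\<gamma> - 1))\<close> and whose roots are \<open>\<alpha>\<^sub>\<plusminus>\<close>. Positivity of \<open>y\<close> is automatic, since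
  \<open>2 y (1 - y) = \<gamma> x\<^sup>2 > 0\<close>. So only the signs of \<open>\<alpha>\<^sub>\<plusminus>\<close> matter; they are read off the sum and
  the product of the roots.
\<close>

lemma denom_pos:
  fixes \<kappa> \<gamma> :: real
  assumes "\<gamma> > 0"
  shows "2 * \<kappa>^2 + \<gamma>^3 > 0"
  using assms by (simp add: add_nonneg_pos)

text \<open>This is the quadratic in \<open>x\<close> with its square completed. Keeping the squared
  form, rather than solving for \<open>x\<close>, leaves the sign of the discriminant open.\<close>

lemma elimination:
  fixes \<kappa> \<gamma> x y :: real
  assumes "\<gamma> > 0" and "\<kappa> * x + \<gamma> * y = 1"
  shows "\<gamma> * x^2 + 2 * y^2 = 2 * y \<longleftrightarrow>
    ((2 * \<kappa>^2 + \<gamma>^3) * x - (2 - \<gamma>) * \<kappa>)^2 = \<gamma>^2 * (\<kappa>^2 + 2 * \<gamma> * (\<gamma> - 1))"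
proof -
  let ?D = "2 * \<kappa>^2 + \<gamma>^3"
  have y: "\<gamma> * y = 1 - \<kappa> * x"
    using assms(2) by simp
  \<comment> \<open>The factor \<open>\<gamma>^2\<close> makes \<open>y\<close> occur only through
    \<open>\<gamma> * y\<close>, so the line can be substituted without division.\<close>
  have "\<gamma>^2 * (\<gamma> * x^2 + 2 * y^2 - 2 * y) = \<gamma>^3 * x^2 + 2 * (\<gamma> * y)^2 - 2 * \<gamma> * (\<gamma> * y)"
    by algebra
  also have "\<dots> = ?D * x^2 - 2 * (2 - \<gamma>) * \<kappa> * x + 2 * (1 - \<gamma>)"
    unfolding y by algebra
  \<comment> \<open>Multiplying by the leading coefficient completes the square; the constant left
    over is the quarter discriminant.\<close>
  finally have "?D * \<gamma>^2 * (\<gamma> * x^2 + 2 * y^2 - 2 * y) =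
      (?D * x - (2 - \<gamma>) * \<kappa>)^2 - \<gamma>^2 * (\<kappa>^2 + 2 * \<gamma> * (\<gamma> - 1))"
    by algebra
  moreover have "?D * \<gamma>^2 \<noteq> 0"
    using assms(1) denom_pos[OF assms(1), of \<kappa>] by simp
  ultimately show ?thesis
    by (metis eq_iff_diff_eq_0 mult_eq_0_iff)
qed

text \<open>Here \<open>t\<close> stands for either signed square root of the radicand. The term
  \<open>- \<kappa> * t\<close> explains the crossed pairing of \<open>alpha_p\<close> with
  \<open>beta_m\<close> and of \<open>alpha_m\<close> with \<open>beta_p\<close>.\<close>

lemma root_on_line:
  fixes \<kappa> \<gamma> x y t :: real
  assumes "\<gamma> > 0" and "x = ((2 - \<gamma>) * \<kappa> + \<gamma> * t) / (2 * \<kappa>^2 + \<gamma>^3)"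
  shows "\<kappa> * x + \<gamma> * y = 1 \<longleftrightarrow> y = (\<kappa>^2 + \<gamma>^2 - \<kappa> * t) / (2 * \<kappa>^2 + \<gamma>^3)"
proof -
  let ?D = "2 * \<kappa>^2 + \<gamma>^3"
  have D: "?D \<noteq> 0"
    using denom_pos[OF assms(1), of \<kappa>] by simp
  then have "?D * x = (2 - \<gamma>) * \<kappa> + \<gamma> * t"
    using assms(2) by simp
  then have "?D * (\<kappa> * x + \<gamma> * y - 1) = \<gamma> * (?D * y - (\<kappa>^2 + \<gamma>^2 - \<kappa> * t))"
    by algebra
  then have "\<kappa> * x + \<gamma> * y = 1 \<longleftrightarrow> ?D * y = \<kappa>^2 + \<gamma>^2 - \<kappa> * t"
    using D assms(1) by (metis eq_iff_diff_eq_0 less_irrefl mult_eq_0_iff)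
  then show ?thesis
    using D by (simp add: eq_divide_eq mult.commute)
qed

text \<open>Reduces every case of the theorem to the signs of the radicand and of the two roots. The
  radicand condition must be explicit: HOL's \<open>sqrt\<close> is total, so the formulas also have
  values where no real root exists.\<close>

lemma sol_set_iff:
  assumes "\<gamma> > 0"
  shows "(x, y) \<in> sol_set \<kappa> \<gamma> \<longleftrightarrow> x > 0 \<and> \<kappa>^2 + 2 * \<gamma> * (\<gamma> - 1) \<ge> 0 \<and>
    (x = alpha_p \<kappa> \<gamma> \<and> y = beta_m \<kappa> \<gamma> \<or> x = alpha_m \<kappa> \<gamma> \<and> y = beta_p \<kappa> \<gamma>)"
proof -
  let ?D = "2 * \<kappa>^2 + \<gamma>^3" and ?\<Delta> = "\<kappa>^2 + 2 * \<gamma> * (\<gamma> - 1)"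
  have D: "?D > 0"
    using denom_pos[OF assms] .
  have ypos: "y > 0" if "x > 0" and "\<gamma> * x^2 + 2 * y^2 = 2 * y"
  proof -
    have "\<gamma> * x^2 > 0"
      using assms that(1) by simp
    moreover have "y^2 \<ge> 0"
      by simp
    ultimately show ?thesis
      using that(2) by linarith
  qed
  have sq: "(?D * x - (2 - \<gamma>) * \<kappa>)^2 = \<gamma>^2 * ?\<Delta> \<longleftrightarrow>
      ?\<Delta> \<ge> 0 \<and> (x = alpha_p \<kappa> \<gamma> \<or> x = alpha_m \<kappa> \<gamma>)"
  proof (cases "?\<Delta> \<ge> 0")
    case True
    then have "\<gamma>^2 * ?\<Delta> = (\<gamma> * sqrt ?\<Delta>)^2"
      by (simp add: power_mult_distrib)
    then have "(?D * x - (2 - \<gamma>) * \<kappa>)^2 = \<gamma>^2 * ?\<Delta> \<longleftrightarrow>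
        ?D * x - (2 - \<gamma>) * \<kappa> = \<gamma> * sqrt ?\<Delta> \<or> ?D * x - (2 - \<gamma>) * \<kappa> = - (\<gamma> * sqrt ?\<Delta>)"
      by (simp only: power2_eq_iff)
    also have "\<dots> \<longleftrightarrow> x = alpha_p \<kappa> \<gamma> \<or> x = alpha_m \<kappa> \<gamma>"
      unfolding alpha_p_def alpha_m_def using D by (auto simp: eq_divide_eq mult.commute)
    finally show ?thesis
      using True by simp
  next
    case False
    then have "\<gamma>^2 * ?\<Delta> < 0"
      using assms by (simp add: mult_pos_neg)
    then have "(?D * x - (2 - \<gamma>) * \<kappa>)^2 \<noteq> \<gamma>^2 * ?\<Delta>"
      by (metis not_less zero_le_power2)
    then show ?thesis
      using False by simp
  qed
  have line_p: "\<kappa> * x + \<gamma> * y = 1 \<longleftrightarrow> y = beta_m \<kappa> \<gamma>" if "x = alpha_p \<kappa> \<gamma>"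
    unfolding beta_m_def by (rule root_on_line[OF assms that[unfolded alpha_p_def]])
  have line_m: "\<kappa> * x + \<gamma> * y = 1 \<longleftrightarrow> y = beta_p \<kappa> \<gamma>" if "x = alpha_m \<kappa> \<gamma>"
    \<comment> \<open>The lower root is the instance with the negative square root for
      \<open>t\<close>.\<close>
    using root_on_line[OF assms, of x \<kappa> "- sqrt ?\<Delta>" y] that
    by (simp add: alpha_m_def beta_p_def)
  have "(x, y) \<in> sol_set \<kappa> \<gamma> \<longleftrightarrow> x > 0 \<and> \<kappa> * x + \<gamma> * y = 1 \<and>
      (?D * x - (2 - \<gamma>) * \<kappa>)^2 = \<gamma>^2 * ?\<Delta>"
    unfolding sol_set_def using ypos elimination[OF assms] by auto
  then show ?thesis
    unfolding sq using line_p line_m by blast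
qed

lemma alpha_sum:
  "alpha_p \<kappa> \<gamma> + alpha_m \<kappa> \<gamma> = 2 * (2 - \<gamma>) * \<kappa> / (2 * \<kappa>^2 + \<gamma>^3)"
  unfolding alpha_p_def alpha_m_def by (simp flip: add_divide_distrib)

text \<open>By Vieta: the product of the numerators is a difference of squares containing one factor
  of the denominator. A nonnegative radicand ensures that \<open>sqrt\<close> squares back to
  it.\<close>

lemma alpha_prod:
  assumes "\<gamma> > 0" and "\<kappa>^2 + 2 * \<gamma> * (\<gamma> - 1) \<ge> 0"
  shows "alpha_p \<kappa> \<gamma> * alpha_m \<kappa> \<gamma> = 2 * (1 - \<gamma>) / (2 * \<kappa>^2 + \<gamma>^3)"
proof -
  let ?D = "2 * \<kappa>^2 + \<gamma>^3"
  define s where "s = sqrt (\<kappa>^2 + 2 * \<gamma> * (\<gamma> - 1))"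
  have "s^2 = \<kappa>^2 + 2 * \<gamma> * (\<gamma> - 1)"
    unfolding s_def using assms(2) by simp
  then have "((2 - \<gamma>) * \<kappa> + \<gamma> * s) * ((2 - \<gamma>) * \<kappa> - \<gamma> * s) = 2 * (1 - \<gamma>) * ?D"
    by algebra
  then show ?thesis
    unfolding alpha_p_def alpha_m_def s_def[symmetric]
    using denom_pos[OF assms(1), of \<kappa>] by simp
qed

lemma alpha_m_le_alpha_p:
  assumes "\<gamma> > 0" and "\<kappa>^2 + 2 * \<gamma> * (\<gamma> - 1) \<ge> 0"
  shows "alpha_m \<kappa> \<gamma> \<le> alpha_p \<kappa> \<gamma>"
proof -
  have "0 \<le> \<gamma> * sqrt (\<kappa>^2 + 2 * \<gamma> * (\<gamma> - 1))"
    using assms by simp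
  then show ?thesis
    unfolding alpha_p_def alpha_m_def using denom_pos[OF assms(1), of \<kappa>]
    by (intro divide_right_mono) linarith+
qed

lemma same_sign_if_prod_pos:
  fixes a b :: real
  assumes "a * b > 0"
  shows "a > 0 \<longleftrightarrow> a + b > 0" and "b > 0 \<longleftrightarrow> a + b > 0"
  using assms by (auto simp: zero_less_mult_iff)

text \<open>For \<gamma> < 1 the product of the roots is positive, so both have the sign of their
  sum, which is that of \<kappa> since 2 - \<gamma> > 0.\<close>

lemma alpha_pos_iff:
  assumes "0 < \<gamma>" and "\<gamma> < 1" and "\<kappa>^2 + 2 * \<gamma> * (\<gamma> - 1) \<ge> 0"
  shows "alpha_p \<kappa> \<gamma> > 0 \<longleftrightarrow> \<kappa> > 0" and "alpha_m \<kappa> \<gamma> > 0 \<longleftrightarrow> \<kappa> > 0"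
proof -
  have D: "2 * \<kappa>^2 + \<gamma>^3 > 0"
    using denom_pos[OF assms(1)] .
  have prod: "alpha_p \<kappa> \<gamma> * alpha_m \<kappa> \<gamma> > 0"
    using alpha_prod[OF assms(1,3)] assms(2) D by simp
  have sum: "alpha_p \<kappa> \<gamma> + alpha_m \<kappa> \<gamma> > 0 \<longleftrightarrow> \<kappa> > 0"
    unfolding alpha_sum using assms(2) D by (simp add: zero_less_divide_iff zero_less_mult_iff)
  show "alpha_p \<kappa> \<gamma> > 0 \<longleftrightarrow> \<kappa> > 0" "alpha_m \<kappa> \<gamma> > 0 \<longleftrightarrow> \<kappa> > 0"
    using same_sign_if_prod_pos[OF prod] sum by simp_all
qed

text \<open>For \<gamma> > 1 the product of the roots is negative, and their order tells which one
  is positive.\<close>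

lemma alpha_signs_gt_1:
  assumes "\<gamma> > 1"
  shows "alpha_p \<kappa> \<gamma> > 0" and "alpha_m \<kappa> \<gamma> < 0"
proof -
  have \<gamma>: "\<gamma> > 0" and \<Delta>: "\<kappa>^2 + 2 * \<gamma> * (\<gamma> - 1) \<ge> 0"
    using assms by simp_all
  have "alpha_p \<kappa> \<gamma> * alpha_m \<kappa> \<gamma> < 0"
    using alpha_prod[OF \<gamma> \<Delta>] denom_pos[OF \<gamma>, of \<kappa>] assms by (simp add: divide_neg_pos)
  then show "alpha_p \<kappa> \<gamma> > 0" "alpha_m \<kappa> \<gamma> < 0"
    using alpha_m_le_alpha_p[OF \<gamma> \<Delta>] by (auto simp: mult_less_0_iff)
qed

text \<open>At \<gamma> = 1 the square root is the absolute value of \<kappa>, so the numerators are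
  \<kappa> plus or minus that value.\<close>

lemma alpha_signs_eq_1:
  shows "alpha_p \<kappa> 1 > 0 \<longleftrightarrow> \<kappa> > 0" and "\<not> alpha_m \<kappa> 1 > 0"
proof -
  have "2 * \<kappa>^2 + 1 > 0"
    using denom_pos[of 1 \<kappa>] by simp
  then show "alpha_p \<kappa> 1 > 0 \<longleftrightarrow> \<kappa> > 0" "\<not> alpha_m \<kappa> 1 > 0"
    by (auto simp: alpha_p_def alpha_m_def zero_less_divide_iff)
qed

lemma disc_nonneg_iff:
  fixes \<kappa> \<gamma> :: real
  assumes "\<kappa> > 0"
  shows "\<kappa>^2 + 2 * \<gamma> * (\<gamma> - 1) \<ge> 0 \<longleftrightarrow> \<kappa> \<ge> sqrt (2 * \<gamma> * (1 - \<gamma>))"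
proof -
  \<comment> \<open>Positivity of \<kappa> lets it be written as \<open>sqrt (\<kappa>^2)\<close>;
    HOL's \<open>sqrt\<close> is strictly increasing on all reals, so the radicands can be
    compared.\<close>
  have "\<kappa> \<ge> sqrt (2 * \<gamma> * (1 - \<gamma>)) \<longleftrightarrow> sqrt (\<kappa>^2) \<ge> sqrt (2 * \<gamma> * (1 - \<gamma>))"
    using assms by simp
  also have "\<dots> \<longleftrightarrow> \<kappa>^2 + 2 * \<gamma> * (\<gamma> - 1) \<ge> 0"
    unfolding real_sqrt_le_iff by (simp add: algebra_simps)
  finally show ?thesis ..
qed

theorem proposition1:
  fixes \<kappa> \<gamma> :: real
  assumes "\<gamma> > 0"
  shows "((\<kappa>, \<gamma>) \<in> J0 \<longrightarrow> sol_set \<kappa> \<gamma> = {}) \<and>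
    ((\<kappa>, \<gamma>) \<in> J1 \<longrightarrow> sol_set \<kappa> \<gamma> = {(alpha_p \<kappa> \<gamma>, beta_m \<kappa> \<gamma>)}) \<and>
    ((\<kappa>, \<gamma>) \<in> J2 \<longrightarrow>
      sol_set \<kappa> \<gamma> = {(alpha_p \<kappa> \<gamma>, beta_m \<kappa> \<gamma>), (alpha_m \<kappa> \<gamma>, beta_p \<kappa> \<gamma>)}) \<and>
    ((\<kappa>, \<gamma>) \<in> J3 \<longrightarrow> sol_set \<kappa> \<gamma> = {(alpha_0 \<kappa> \<gamma>, beta_0 \<kappa> \<gamma>)})"
proof -
  let ?\<Delta> = "\<kappa>^2 + 2 * \<gamma> * (\<gamma> - 1)"
  have iff: "(x, y) \<in> sol_set \<kappa> \<gamma> \<longleftrightarrow> x > 0 \<and> ?\<Delta> \<ge> 0 \<and>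
      (x = alpha_p \<kappa> \<gamma> \<and> y = beta_m \<kappa> \<gamma> \<or> x = alpha_m \<kappa> \<gamma> \<and> y = beta_p \<kappa> \<gamma>)" for x y
    by (rule sol_set_iff[OF assms])
  \<comment> \<open>Serves both \<open>J2\<close> and \<open>J3\<close>: the threshold is positive,
    which forces \<kappa> > 0.\<close>
  have lt_1: "\<kappa> > 0 \<and> ?\<Delta> \<ge> 0 \<and> alpha_p \<kappa> \<gamma> > 0 \<and> alpha_m \<kappa> \<gamma> > 0"
    if "\<gamma> < 1" and "\<kappa> \<ge> sqrt (2 * \<gamma> * (1 - \<gamma>))"
  proof -
    have "sqrt (2 * \<gamma> * (1 - \<gamma>)) > 0"
      using assms that(1) by simp
    then have "\<kappa> > 0"
      using that(2) by linarith
    moreover from this have "?\<Delta> \<ge> 0"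
      using that(2) disc_nonneg_iff by blast
    ultimately show ?thesis
      using alpha_pos_iff assms that(1) by blast
  qed
  have "sol_set \<kappa> \<gamma> = {}" if J0: "(\<kappa>, \<gamma>) \<in> J0"
  proof -
    have "\<not> (\<gamma> > 1)" and eq_1: "\<gamma> = 1 \<Longrightarrow> \<not> \<kappa> > 0"
      and lt_1: "\<gamma> < 1 \<Longrightarrow> \<not> \<kappa> \<ge> sqrt (2 * \<gamma> * (1 - \<gamma>))"
      using J0 assms by (auto simp: J0_def J1_def J2_def J3_def)
    then consider "\<gamma> = 1" | "\<gamma> < 1"
      by linarith
    then have "\<not> (?\<Delta> \<ge> 0 \<and> (alpha_p \<kappa> \<gamma> > 0 \<or> alpha_m \<kappa> \<gamma> > 0))"
    proof cases
      case 1
      then show ?thesis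
        using eq_1 alpha_signs_eq_1 by blast
    next
      case 2
      \<comment> \<open>Below the threshold, a positive \<kappa> makes the radicand negative, while
        for \<kappa> \<le> 0 neither root is positive.\<close>
      then show ?thesis
        using lt_1 alpha_pos_iff assms disc_nonneg_iff by blast
    qed
    then show ?thesis
      using iff by auto
  qed
  moreover have "sol_set \<kappa> \<gamma> = {(alpha_p \<kappa> \<gamma>, beta_m \<kappa> \<gamma>)}" if J1: "(\<kappa>, \<gamma>) \<in> J1"
  proof -
    consider "\<gamma> > 1" | "\<gamma> = 1" "\<kappa> > 0"
      using J1 by (auto simp: J1_def le_less)
    then have "?\<Delta> \<ge> 0 \<and> alpha_p \<kappa> \<gamma> > 0 \<and> \<not> alpha_m \<kappa> \<gamma> > 0"
    proof cases
      case 1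
      then show ?thesis
        using alpha_signs_gt_1[OF 1, of \<kappa>] by simp
    next
      case 2
      then show ?thesis
        using alpha_signs_eq_1[of \<kappa>] by simp
    qed
    then show ?thesis
      using iff by auto
  qed
  moreover have "sol_set \<kappa> \<gamma> = {(alpha_p \<kappa> \<gamma>, beta_m \<kappa> \<gamma>), (alpha_m \<kappa> \<gamma>, beta_p \<kappa> \<gamma>)}"
    if J2: "(\<kappa>, \<gamma>) \<in> J2"
  proof -
    have "?\<Delta> \<ge> 0 \<and> alpha_p \<kappa> \<gamma> > 0 \<and> alpha_m \<kappa> \<gamma> > 0"
      using J2 lt_1 by (auto simp: J2_def)
    then show ?thesis
      using iff by auto
  qed
  moreover have "sol_set \<kappa> \<gamma> = {(alpha_0 \<kappa> \<gamma>, beta_0 \<kappa> \<gamma>)}" if J3: "(\<kappa>, \<gamma>) \<in> J3"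
  proof -
    have lt: "\<gamma> < 1" and \<kappa>: "\<kappa> = sqrt (2 * \<gamma> * (1 - \<gamma>))"
      using J3 by (auto simp: J3_def)
    have "\<kappa>^2 = 2 * \<gamma> * (1 - \<gamma>)"
      unfolding \<kappa> using assms lt by simp
    \<comment> \<open>On the threshold the radicand vanishes and the two candidate points merge into
      one.\<close>
    then have "?\<Delta> = 0"
      by algebra
    then have "alpha_p \<kappa> \<gamma> = alpha_0 \<kappa> \<gamma>" "alpha_m \<kappa> \<gamma> = alpha_0 \<kappa> \<gamma>"
      "beta_p \<kappa> \<gamma> = beta_0 \<kappa> \<gamma>" "beta_m \<kappa> \<gamma> = beta_0 \<kappa> \<gamma>"
      unfolding alpha_p_def alpha_m_def beta_p_def beta_m_def alpha_0_def beta_0_def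
      by simp_all
    moreover have "?\<Delta> \<ge> 0 \<and> alpha_p \<kappa> \<gamma> > 0"
      using lt_1[OF lt] \<kappa> by blast
    ultimately show ?thesis
      using iff by auto
  qed
  ultimately show ?thesis
    by blast
qed

end
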